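(* Let $X$ be a Urysohn space. Then $|X|\le 2^{\overline{\Delta}(X)\cdot 2^{wL(X)}}$.
   Context: A topological space $X$ is Urysohn if every two distinct points of $X$ have disjoint closed neighborhoods. Write $\Delta_X=\{(x,x)\in X^2:x\in X\}$. For an infinite cardinal $\kappa$, $X$ has a regular $G_\kappa$-diagonal if there is a family $(U_\eta:\eta<\kappa)$ of open sets in $X^2$ such that $\Delta_X=\bigcap_{\eta<\kappa}U_\eta=\bigcap_{\eta<\kappa}\overline{U_\eta}$. For a Urysohn space $X$, the regular diagonal degree $\overline{\Delta}(X)$ is the minimal infinite cardinal $\kappa$ such that $X$ has a regular $G_\kappa$-diagonal. The weak Lindelöf number $wL(X)$ is the smallest infinite cardinal $\kappa$ such that every open cover of $X$ has a subcollection of cardinality $\le\kappa$ whose union is dense in $X$. *)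

theory Defs
  imports "HOL-Analysis.Analysis"
begin

unbundle cardinal_syntax
no_notation elt_set_eq (infix "=o" 50)

text \<open>
  A cardinal is a cardinal order on some type (\<^const>\<open>card_order_on\<close>); an infinite cardinal
  is a relation \<open>\<kappa>\<close> with \<open>Cinfinite \<kappa>\<close>, and the elements of \<open>Field \<kappa>\<close> play the role of
  the ordinals \<open>\<eta> < \<kappa>\<close>.  A space is an abstract topology with carrier \<open>topspace X\<close>.
\<close>

definition Urysohn_space :: "'a topology \<Rightarrow> bool" where
  "Urysohn_space X \<longleftrightarrow>
     (\<forall>x\<in>topspace X. \<forall>y\<in>topspace X. x \<noteq> y \<longrightarrow>
        (\<exists>C D. closedin X C \<and> closedin X D \<and> x \<in> X interior_of C \<and> y \<in> X interior_of D \<and> C \<inter> D = {}))"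

definition diagonal_of :: "'a topology \<Rightarrow> ('a \<times> 'a) set" where
  "diagonal_of X = {(x, x) |x. x \<in> topspace X}"

definition regular_G_diagonal :: "'a topology \<Rightarrow> 'k rel \<Rightarrow> bool" where
  "regular_G_diagonal X \<kappa> \<longleftrightarrow>
     (\<exists>U :: 'k \<Rightarrow> ('a \<times> 'a) set.
        (\<forall>\<eta>\<in>Field \<kappa>. openin (prod_topology X X) (U \<eta>)) \<and>
        diagonal_of X = (\<Inter>\<eta>\<in>Field \<kappa>. U \<eta>) \<and>
        diagonal_of X = (\<Inter>\<eta>\<in>Field \<kappa>. prod_topology X X closure_of U \<eta>))"

definition weakly_Lindelof :: "'a topology \<Rightarrow> 'k rel \<Rightarrow> bool" where
  "weakly_Lindelof X \<kappa> \<longleftrightarrow>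
     (\<forall>\<U>. (\<forall>U\<in>\<U>. openin X U) \<and> \<Union>\<U> = topspace X \<longrightarrow>
        (\<exists>\<V>\<subseteq>\<U>. |\<V>| \<le>o \<kappa> \<and> X closure_of (\<Union>\<V>) = topspace X))"

definition least_infinite_cardinal :: "('k rel \<Rightarrow> bool) \<Rightarrow> 'k rel" where
  "least_infinite_cardinal P =
     (SOME \<kappa>. Cinfinite \<kappa> \<and> P \<kappa> \<and> (\<forall>\<kappa>'. Cinfinite \<kappa>' \<and> P \<kappa>' \<longrightarrow> \<kappa> \<le>o \<kappa>'))"

text \<open>
  A definition has to fix the type on which the least cardinal is represented.  The types below
  are large enough for such cardinals to exist, and the lemmas at the end of this theory show
  that the result is least among the cardinals on \<^emph>\<open>all\<close> types.
\<close>

definition regular_diagonal_degree :: "'a topology \<Rightarrow> ('a \<times> 'a + nat) rel" where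
  "regular_diagonal_degree X = least_infinite_cardinal (regular_G_diagonal X)"

definition weak_Lindelof_number :: "'a topology \<Rightarrow> ('a + nat) rel" where
  "weak_Lindelof_number X = least_infinite_cardinal (weakly_Lindelof X)"

lemma least_infinite_cardinal:
  assumes "Cinfinite \<kappa>0" "P \<kappa>0"
  shows "Cinfinite (least_infinite_cardinal P)" "P (least_infinite_cardinal P)"
    and "\<And>\<kappa>'. Cinfinite \<kappa>' \<Longrightarrow> P \<kappa>' \<Longrightarrow> least_infinite_cardinal P \<le>o \<kappa>'"
proof -
  have "\<exists>\<kappa>\<in>{\<kappa>. Cinfinite \<kappa> \<and> P \<kappa>}. \<forall>\<kappa>'\<in>{\<kappa>. Cinfinite \<kappa> \<and> P \<kappa>}. \<kappa> \<le>o \<kappa>'"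
    by (rule exists_minim_Card_order) (use assms in auto)
  then have "\<exists>\<kappa>. Cinfinite \<kappa> \<and> P \<kappa> \<and> (\<forall>\<kappa>'. Cinfinite \<kappa>' \<and> P \<kappa>' \<longrightarrow> \<kappa> \<le>o \<kappa>')"
    by auto
  from someI_ex[OF this]
  have *: "Cinfinite (least_infinite_cardinal P) \<and> P (least_infinite_cardinal P) \<and>
      (\<forall>\<kappa>'. Cinfinite \<kappa>' \<and> P \<kappa>' \<longrightarrow> least_infinite_cardinal P \<le>o \<kappa>')"
    unfolding least_infinite_cardinal_def .
  then show "Cinfinite (least_infinite_cardinal P)" "P (least_infinite_cardinal P)"
    "\<And>\<kappa>'. Cinfinite \<kappa>' \<Longrightarrow> P \<kappa>' \<Longrightarrow> least_infinite_cardinal P \<le>o \<kappa>'"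
    by blast+
qed

lemma least_infinite_cardinal_le:
  fixes P :: "'k rel \<Rightarrow> bool" and \<kappa>' :: "'l rel"
  assumes "Cinfinite \<kappa>0" "P \<kappa>0" "Cinfinite \<kappa>'"
    and transfer: "\<And>\<mu>. Cinfinite \<mu> \<Longrightarrow> \<kappa>' =o \<mu> \<Longrightarrow> P \<mu>"
  shows "least_infinite_cardinal P \<le>o \<kappa>'"
proof (rule ccontr)
  let ?l = "least_infinite_cardinal P"
  assume nle: "\<not> ?l \<le>o \<kappa>'"
  have l: "Cinfinite ?l" using least_infinite_cardinal(1)[of \<kappa>0 P] assms by blast
  then have "\<kappa>' \<le>o ?l"
    using nle assms(3) not_ordLeq_iff_ordLess[of ?l \<kappa>'] ordLess_imp_ordLeq
    by (auto simp: card_order_on_def)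
  then obtain \<mu> :: "'k rel" where \<mu>: "\<kappa>' =o \<mu>"
    using internalize_ordLeq[of \<kappa>' ?l] by blast
  then have "Cinfinite \<mu>" using Cinfinite_cong assms(3) by blast
  then have "?l \<le>o \<mu>"
    using least_infinite_cardinal(3)[of \<kappa>0 P \<mu>] assms(1,2) transfer[OF _ \<mu>] by blast
  then have "?l \<le>o \<kappa>'" using \<mu> ordIso_symmetric ordLeq_ordIso_trans by blast
  with nle show False ..
qed

lemma regular_G_diagonal_cong:
  fixes \<kappa> :: "'k rel" and \<mu> :: "'l rel"
  assumes "regular_G_diagonal X \<kappa>" "\<kappa> =o \<mu>"
  shows "regular_G_diagonal X \<mu>"
proof -
  obtain U where U: "\<forall>\<eta>\<in>Field \<kappa>. openin (prod_topology X X) (U \<eta>)"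
      "diagonal_of X = (\<Inter>\<eta>\<in>Field \<kappa>. U \<eta>)"
      "diagonal_of X = (\<Inter>\<eta>\<in>Field \<kappa>. prod_topology X X closure_of U \<eta>)"
    using assms(1) unfolding regular_G_diagonal_def by blast
  obtain f where "bij_betw f (Field \<mu>) (Field \<kappa>)"
    using ordIso_symmetric[OF assms(2)] unfolding ordIso_def iso_def by auto
  then have f: "f ` Field \<mu> = Field \<kappa>" by (simp add: bij_betw_def)
  have "(\<Inter>\<eta>\<in>Field \<mu>. V (f \<eta>)) = (\<Inter>\<eta>\<in>Field \<kappa>. V \<eta>)" for V :: "'k \<Rightarrow> ('a \<times> 'a) set"
    unfolding f[symmetric] by simp
  from U this[of U] this[of "\<lambda>\<eta>. prod_topology X X closure_of U \<eta>"] f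
  show ?thesis
    unfolding regular_G_diagonal_def by (intro exI[of _ "\<lambda>\<eta>. U (f \<eta>)"]) auto
qed

lemma weakly_Lindelof_cong:
  assumes "weakly_Lindelof X \<kappa>" "\<kappa> =o \<mu>"
  shows "weakly_Lindelof X \<mu>"
  using assms ordLeq_ordIso_trans unfolding weakly_Lindelof_def by meson

lemma Cinfinite_UNIV_plus_nat: "Cinfinite |UNIV :: ('b + nat) set|"
  by (simp add: cinfinite_def Field_card_of card_of_card_order_on)

lemma regular_G_diagonal_UNIV:
  fixes X :: "'a topology"
  assumes "Urysohn_space X"
  shows "regular_G_diagonal X |UNIV :: ('a \<times> 'a + nat) set|"
proof -
  let ?Y = "prod_topology X X"
  have top: "topspace ?Y = topspace X \<times> topspace X" by simp
  have "\<exists>U. openin ?Y U \<and> diagonal_of X \<subseteq> U \<and> (x \<noteq> y \<longrightarrow> (x, y) \<notin> ?Y closure_of U)" for x y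
  proof (cases "x \<in> topspace X \<and> y \<in> topspace X \<and> x \<noteq> y")
    case False
    then show ?thesis
    proof (cases "x = y")
      case True
      then show ?thesis
        using openin_topspace[of ?Y] by (intro exI[of _ "topspace ?Y"]) (auto simp: diagonal_of_def)
    next
      case False
      with \<open>\<not> (x \<in> topspace X \<and> y \<in> topspace X \<and> x \<noteq> y)\<close>
      have "(x, y) \<notin> topspace ?Y" by auto
      then have "(x, y) \<notin> ?Y closure_of topspace ?Y"
        using closure_of_subset_topspace by fastforce
      then show ?thesis
        using openin_topspace[of ?Y] by (intro exI[of _ "topspace ?Y"]) (auto simp: diagonal_of_def)
    qed
  next
    case True
    then obtain C D where CD: "closedin X C" "closedin X D" "x \<in> X interior_of C"
        "y \<in> X interior_of D" "C \<inter> D = {}"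
      using assms unfolding Urysohn_space_def by blast
    let ?U = "topspace ?Y - C \<times> D"
    have "closedin ?Y (C \<times> D)" using CD by (simp add: closedin_prod_Times_iff)
    then have "openin ?Y ?U" by blast
    moreover have "diagonal_of X \<subseteq> ?U" using CD(5) by (auto simp: diagonal_of_def)
    moreover have "(x, y) \<notin> ?Y closure_of ?U"
    proof
      assume cl: "(x, y) \<in> ?Y closure_of ?U"
      have "openin ?Y ((X interior_of C) \<times> (X interior_of D))"
        by (simp add: openin_prod_Times_iff)
      moreover have "(x, y) \<in> (X interior_of C) \<times> (X interior_of D)"
        using CD(3,4) by simp
      ultimately obtain z where "z \<in> ?U" "z \<in> (X interior_of C) \<times> (X interior_of D)"
        using cl unfolding in_closure_of by meson
      then show False using interior_of_subset[of X C] interior_of_subset[of X D] by auto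
    qed
    ultimately show ?thesis by blast
  qed
  then obtain W where W: "\<And>x y. openin ?Y (W x y)" "\<And>x y. diagonal_of X \<subseteq> W x y"
      "\<And>x y. x \<noteq> y \<Longrightarrow> (x, y) \<notin> ?Y closure_of W x y"
    by metis
  define U where "U = (\<lambda>\<eta>::'a \<times> 'a + nat. case \<eta> of Inl p \<Rightarrow> W (fst p) (snd p) | Inr n \<Rightarrow> topspace ?Y)"
  have op: "openin ?Y (U \<eta>)" for \<eta>
    using W(1) unfolding U_def by (cases \<eta>) (simp_all only: sum.case openin_topspace)
  have dU: "diagonal_of X \<subseteq> U \<eta>" for \<eta>
  proof (cases \<eta>)
    case (Inl p)
    then show ?thesis using W(2) by (simp add: U_def)
  next
    case (Inr n)
    then show ?thesis by (auto simp: U_def diagonal_of_def)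
  qed
  have Ucl: "U \<eta> \<subseteq> ?Y closure_of U \<eta>" for \<eta>
    by (rule closure_of_subset[OF openin_subset[OF op]])
  have "(\<Inter>\<eta>. ?Y closure_of U \<eta>) \<subseteq> diagonal_of X"
  proof
    fix p assume p: "p \<in> (\<Inter>\<eta>. ?Y closure_of U \<eta>)"
    then have "p \<in> ?Y closure_of U (Inl p)" by blast
    then have "fst p = snd p" using W(3)[of "fst p" "snd p"] by (auto simp: U_def)
    moreover have "p \<in> topspace ?Y" using p by (meson INT_D UNIV_I in_closure_of)
    ultimately show "p \<in> diagonal_of X" by (cases p) (auto simp: diagonal_of_def)
  qed
  moreover have "diagonal_of X \<subseteq> (\<Inter>\<eta>. U \<eta>)" using dU by blast
  moreover have "(\<Inter>\<eta>. U \<eta>) \<subseteq> (\<Inter>\<eta>. ?Y closure_of U \<eta>)" using Ucl by blast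
  ultimately have "diagonal_of X = (\<Inter>\<eta>. U \<eta>)"
      "diagonal_of X = (\<Inter>\<eta>. ?Y closure_of U \<eta>)"
    by (metis subset_antisym subset_trans)+
  then show ?thesis
    unfolding regular_G_diagonal_def Field_card_of using op by (intro exI[of _ U]) simp
qed

lemma weakly_Lindelof_UNIV:
  fixes X :: "'a topology"
  shows "weakly_Lindelof X |UNIV :: ('a + nat) set|"
  unfolding weakly_Lindelof_def
proof (intro allI impI)
  fix \<U> assume \<U>: "(\<forall>U\<in>\<U>. openin X U) \<and> \<Union>\<U> = topspace X"
  then have "\<forall>x\<in>topspace X. \<exists>U\<in>\<U>. x \<in> U" by blast
  then obtain f where f: "\<And>x. x \<in> topspace X \<Longrightarrow> f x \<in> \<U> \<and> x \<in> f x" by metis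
  have "|f ` topspace X| \<le>o |topspace X|" by (rule card_of_image)
  also have "|topspace X| \<le>o |UNIV :: ('a + nat) set|"
    by (rule card_of_ordLeqI[of Inl]) auto
  finally have "|f ` topspace X| \<le>o |UNIV :: ('a + nat) set|" .
  moreover have "\<Union>(f ` topspace X) = topspace X" using f \<U> by blast
  moreover have "f ` topspace X \<subseteq> \<U>" using f by blast
  ultimately show "\<exists>\<V>\<subseteq>\<U>. |\<V>| \<le>o |UNIV :: ('a + nat) set| \<and> X closure_of \<Union>\<V> = topspace X"
    by (metis closure_of_topspace)
qed

lemma regular_diagonal_degree:
  assumes "Urysohn_space X"
  shows "Cinfinite (regular_diagonal_degree X)"
    and "regular_G_diagonal X (regular_diagonal_degree X)"
  unfolding regular_diagonal_degree_def
  using least_infinite_cardinal(1,2)[of _ "regular_G_diagonal X",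
      OF Cinfinite_UNIV_plus_nat regular_G_diagonal_UNIV[OF assms]]
  by blast+

lemma regular_diagonal_degree_le:
  fixes X :: "'a topology" and \<kappa> :: "'k rel"
  assumes "Urysohn_space X" "Cinfinite \<kappa>" "regular_G_diagonal X \<kappa>"
  shows "regular_diagonal_degree X \<le>o \<kappa>"
  unfolding regular_diagonal_degree_def
  by (rule least_infinite_cardinal_le[where P = "regular_G_diagonal X", OF Cinfinite_UNIV_plus_nat
        regular_G_diagonal_UNIV[OF assms(1)] assms(2)])
    (rule regular_G_diagonal_cong[OF assms(3)])

lemma weak_Lindelof_number:
  shows "Cinfinite (weak_Lindelof_number X)" and "weakly_Lindelof X (weak_Lindelof_number X)"
  unfolding weak_Lindelof_number_def
  using least_infinite_cardinal(1,2)[of _ "weakly_Lindelof X",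
      OF Cinfinite_UNIV_plus_nat weakly_Lindelof_UNIV]
  by blast+

lemma weak_Lindelof_number_le:
  fixes X :: "'a topology" and \<kappa> :: "'k rel"
  assumes "Cinfinite \<kappa>" "weakly_Lindelof X \<kappa>"
  shows "weak_Lindelof_number X \<le>o \<kappa>"
  unfolding weak_Lindelof_number_def
  by (rule least_infinite_cardinal_le[where P = "weakly_Lindelof X", OF Cinfinite_UNIV_plus_nat
        weakly_Lindelof_UNIV assms(1)])
    (rule weakly_Lindelof_cong[OF assms(2)])

end

theory Submission
  imports Defs
begin

text \<open>
  For each \<open>\<eta>\<close> pick at most \<open>\<kappa> = wL(X)\<close> open sets \<open>G\<close> with \<open>G \<times> G \<subseteq> U\<^sub>\<eta>\<close> and dense union; call
  this family \<open>\<Gamma>\<^sub>\<eta>\<close>.  A point \<open>x\<close> leaves on \<open>\<Gamma>\<^sub>\<eta>\<close> the trace consisting of all subfamilies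
  \<open>{G \<in> \<Gamma>\<^sub>\<eta>. G \<inter> N \<noteq> {}}\<close>, with \<open>N\<close> an open neighbourhood of \<open>x\<close>.  If \<open>x \<noteq> y\<close> then some
  \<open>N \<times> M\<close> around \<open>(x, y)\<close> misses some \<open>U\<^sub>\<eta>\<close>, so that no \<open>G \<in> \<Gamma>\<^sub>\<eta>\<close> meets both \<open>N\<close> and \<open>M\<close>, and
  by density the traces of \<open>x\<close> and \<open>y\<close> on \<open>\<Gamma>\<^sub>\<eta>\<close> differ.  A point is therefore determined by a
  choice of \<open>\<Delta>(X)\<close> many sets of subsets of \<open>\<kappa>\<close>.
\<close>

lemma card_of_Pow_ordIso_cexp: "|Pow (Field \<kappa>)| =o ctwo ^c \<kappa>"
  by (simp add: cexp_def ctwo_def Field_card_of card_of_Pow_Func)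

text \<open>A subset of the product amounts to a choice, for each \<eta>, of a set of subsets of
  \<open>Field \<kappa>\<close>; this counts the codes available to points.\<close>

lemma card_of_Pow_Times_Pow_ordLeq:
  fixes \<delta> :: "'d rel" and \<kappa> :: "'k rel"
  shows "|Pow (Field \<delta> \<times> Pow (Field \<kappa>))| \<le>o ctwo ^c (\<delta> *c (ctwo ^c \<kappa>))"
proof -
  have "|Pow (Field \<delta> \<times> Pow (Field \<kappa>))| =o ctwo ^c |Field \<delta> \<times> Pow (Field \<kappa>)|"
    using card_of_Pow_ordIso_cexp[of "|Field \<delta> \<times> Pow (Field \<kappa>)|"] by (simp add: Field_card_of)
  moreover have "|Field \<delta> \<times> Pow (Field \<kappa>)| \<le>o \<delta> *c (ctwo ^c \<kappa>)"
    using ordIso_imp_ordLeq[OF card_of_Pow_Func[of "Field \<kappa>"]]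
    by (simp add: cprod_def cexp_def ctwo_def Field_card_of card_of_Times_mono2)
  then have "ctwo ^c |Field \<delta> \<times> Pow (Field \<kappa>)| \<le>o ctwo ^c (\<delta> *c (ctwo ^c \<kappa>))"
    by (rule cexp_mono2'[OF _ Card_order_ctwo]) (auto simp: cprod_def Field_card_of)
  ultimately show ?thesis by (rule ordIso_ordLeq_trans)
qed

text \<open>Around each (x, x) there is an open box \<open>V \<times> W\<close> inside
  \<open>U\<close>, and the square of \<open>V \<inter> W\<close> stays inside it. So the open sets
  with square in \<open>U\<close> cover the space, and weak Lindelofness thins this cover.\<close>

lemma weakly_Lindelof_diagonal_family:
  assumes wL: "weakly_Lindelof X \<kappa>"
    and U: "openin (prod_topology X X) U" "diagonal_of X \<subseteq> U"
  obtains \<Gamma> where "\<And>G. G \<in> \<Gamma> \<Longrightarrow> G \<times> G \<subseteq> U" "|\<Gamma>| \<le>o \<kappa>" "X closure_of \<Union>\<Gamma> = topspace X"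
proof -
  let ?\<G> = "{G. openin X G \<and> G \<times> G \<subseteq> U}"
  have "\<exists>G\<in>?\<G>. x \<in> G" if "x \<in> topspace X" for x
  proof -
    have "(x, x) \<in> U" using that U(2) by (auto simp: diagonal_of_def)
    then obtain V W where "openin X V" "openin X W" "x \<in> V" "x \<in> W" "V \<times> W \<subseteq> U"
      using U(1) unfolding openin_prod_topology_alt by meson
    then show ?thesis by (intro bexI[of _ "V \<inter> W"]) auto
  qed
  then have "\<Union>?\<G> = topspace X" using openin_subset by fast
  then obtain \<Gamma> where "\<Gamma> \<subseteq> ?\<G>" "|\<Gamma>| \<le>o \<kappa>" "X closure_of \<Union>\<Gamma> = topspace X"
    using wL[unfolded weakly_Lindelof_def, rule_format, of ?\<G>] by blast
  then show ?thesis using that by blast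
qed

lemma openin_prod_separation:
  assumes "(x, y) \<in> topspace (prod_topology X Y)" "(x, y) \<notin> prod_topology X Y closure_of U"
  obtains N M where "openin X N" "openin Y M" "x \<in> N" "y \<in> M" "(N \<times> M) \<inter> U = {}"
proof -
  obtain T where T: "openin (prod_topology X Y) T" "(x, y) \<in> T" "T \<inter> U = {}"
    using assms unfolding in_closure_of by blast
  then obtain N M where NM: "openin X N" "openin Y M" "x \<in> N" "y \<in> M" "N \<times> M \<subseteq> T"
    unfolding openin_prod_topology_alt by meson
  then have "(N \<times> M) \<inter> U = {}" using T(3) by blast
  with NM(1-4) show ?thesis by (rule that)
qed

definition trace :: "'a topology \<Rightarrow> 'a set set \<Rightarrow> 'a \<Rightarrow> 'a set set set" where
  "trace X \<Gamma> x = {{G \<in> \<Gamma>. G \<inter> N \<noteq> {}} |N. openin X N \<and> x \<in> N}"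

lemma trace_neq:
  assumes \<Gamma>: "\<And>G. G \<in> \<Gamma> \<Longrightarrow> G \<times> G \<subseteq> U" "X closure_of \<Union>\<Gamma> = topspace X"
    and xy: "x \<in> topspace X" "y \<in> topspace X" "(x, y) \<notin> prod_topology X X closure_of U"
  shows "trace X \<Gamma> x \<noteq> trace X \<Gamma> y"
proof
  assume eq: "trace X \<Gamma> x = trace X \<Gamma> y"
  obtain N M where NM: "openin X N" "openin X M" "x \<in> N" "y \<in> M" "(N \<times> M) \<inter> U = {}"
    by (rule openin_prod_separation[OF _ xy(3)]) (simp add: xy(1,2))
  have "{G \<in> \<Gamma>. G \<inter> N \<noteq> {}} \<in> trace X \<Gamma> x"
    unfolding trace_def using NM(1,3) by (intro CollectI exI[of _ N]) simp
  then have "{G \<in> \<Gamma>. G \<inter> N \<noteq> {}} \<in> trace X \<Gamma> y"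
    unfolding eq .
  then obtain M' where M': "openin X M'" "y \<in> M'"
      "{G \<in> \<Gamma>. G \<inter> N \<noteq> {}} = {G \<in> \<Gamma>. G \<inter> M' \<noteq> {}}"
    unfolding trace_def by blast
  \<comment> \<open>Density is applied to \<open>M \<inter> M'\<close>: \<open>M'\<close> ties a
    member of \<Gamma> to \<open>N\<close> through the equal traces, while \<open>M\<close> keeps
    the point b in the box that misses \<open>U\<close>.\<close>
  have "y \<in> X closure_of \<Union>\<Gamma>" "y \<in> M \<inter> M'" "openin X (M \<inter> M')"
    using \<Gamma>(2) xy(2) NM M' by auto
  then obtain b where "b \<in> \<Union>\<Gamma>" "b \<in> M \<inter> M'"
    unfolding in_closure_of by blast
  then obtain G where G: "G \<in> \<Gamma>" "b \<in> G" "b \<in> M" "b \<in> M'" by blast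
  then have "G \<in> {G \<in> \<Gamma>. G \<inter> N \<noteq> {}}" unfolding M'(3) by blast
  then obtain a where "a \<in> G" "a \<in> N" by blast
  \<comment> \<open>The pair (a, b) lies in \<open>G \<times> G\<close>, hence in \<open>U\<close>,
    and also in \<open>N \<times> M\<close>.\<close>
  then show False using \<Gamma>(1)[OF G(1)] G NM(5) by blast
qed

lemma card_topspace_ordLeq:
  fixes X :: "'a topology" and \<delta> :: "'d rel" and \<kappa> :: "'k rel"
  assumes \<delta>: "regular_G_diagonal X \<delta>" and wL: "weakly_Lindelof X \<kappa>" and \<kappa>: "Card_order \<kappa>"
  shows "|topspace X| \<le>o ctwo ^c (\<delta> *c (ctwo ^c \<kappa>))"
proof -
  obtain U :: "'d \<Rightarrow> ('a \<times> 'a) set"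
    where U: "\<And>\<eta>. \<eta> \<in> Field \<delta> \<Longrightarrow> openin (prod_topology X X) (U \<eta>)"
      "diagonal_of X = (\<Inter>\<eta>\<in>Field \<delta>. U \<eta>)"
      "diagonal_of X = (\<Inter>\<eta>\<in>Field \<delta>. prod_topology X X closure_of U \<eta>)"
    using \<delta> unfolding regular_G_diagonal_def by (elim exE conjE) (rule that, erule (1) bspec)
  have "\<exists>\<Gamma>. (\<forall>G\<in>\<Gamma>. G \<times> G \<subseteq> U \<eta>) \<and> |\<Gamma>| \<le>o \<kappa> \<and> X closure_of \<Union>\<Gamma> = topspace X"
    if "\<eta> \<in> Field \<delta>" for \<eta>
  proof -
    have "diagonal_of X \<subseteq> U \<eta>" using U(2) that by blast
    from weakly_Lindelof_diagonal_family[OF wL U(1)[OF that] this] show ?thesis by metis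
  qed
  then obtain \<Gamma> where \<Gamma>: "\<And>\<eta> G. \<eta> \<in> Field \<delta> \<Longrightarrow> G \<in> \<Gamma> \<eta> \<Longrightarrow> G \<times> G \<subseteq> U \<eta>"
      "\<And>\<eta>. \<eta> \<in> Field \<delta> \<Longrightarrow> |\<Gamma> \<eta>| \<le>o \<kappa>"
      "\<And>\<eta>. \<eta> \<in> Field \<delta> \<Longrightarrow> X closure_of \<Union>(\<Gamma> \<eta>) = topspace X"
    by metis
  \<comment> \<open>The families vary with \<eta>; embedding each into \<open>Field \<kappa>\<close>
    lets all traces be coded inside one fixed set.\<close>
  have "\<exists>e. inj_on e (\<Gamma> \<eta>) \<and> e ` \<Gamma> \<eta> \<subseteq> Field \<kappa>" if "\<eta> \<in> Field \<delta>" for \<eta>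
  proof -
    have "|\<Gamma> \<eta>| \<le>o |Field \<kappa>|"
      using \<Gamma>(2)[OF that] card_of_Field_ordIso[OF \<kappa>] ordIso_symmetric ordLeq_ordIso_trans by blast
    then show ?thesis unfolding card_of_ordLeq .
  qed
  then obtain e where e: "\<And>\<eta>. \<eta> \<in> Field \<delta> \<Longrightarrow> inj_on (e \<eta>) (\<Gamma> \<eta>)"
      "\<And>\<eta>. \<eta> \<in> Field \<delta> \<Longrightarrow> e \<eta> ` \<Gamma> \<eta> \<subseteq> Field \<kappa>"
    by metis
  \<comment> \<open>The code of x is a relation whose section at \<eta> is the trace of x on
    \<open>\<Gamma> \<eta>\<close>, transported by \<open>e \<eta>\<close>. As a set of pairs it
    needs no values outside \<open>Field \<delta>\<close>.\<close>
  define f where "f x = (SIGMA \<eta>:Field \<delta>. (`) (e \<eta>) ` trace X (\<Gamma> \<eta>) x)" for x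
  have trace_Pow: "trace X (\<Gamma> \<eta>) x \<subseteq> Pow (\<Gamma> \<eta>)" for \<eta> x
    unfolding trace_def by blast
  have "inj_on f (topspace X)"
  proof (rule inj_onI, rule ccontr)
    fix x y assume xy: "x \<in> topspace X" "y \<in> topspace X" and eq: "f x = f y" and "x \<noteq> y"
    then have "(x, y) \<notin> diagonal_of X" by (simp add: diagonal_of_def)
    then obtain \<eta> where \<eta>: "\<eta> \<in> Field \<delta>" "(x, y) \<notin> prod_topology X X closure_of U \<eta>"
      unfolding U(3) by blast
    have "f x `` {\<eta>} = f y `` {\<eta>}" using eq by simp
    then have "(`) (e \<eta>) ` trace X (\<Gamma> \<eta>) x = (`) (e \<eta>) ` trace X (\<Gamma> \<eta>) y"
      using \<eta>(1) by (simp add: f_def Image_singleton set_eq_iff)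
    \<comment> \<open>Injectivity of \<open>e \<eta>\<close> is lifted twice: to subfamilies of
      \<open>\<Gamma> \<eta>\<close>, then to sets of subfamilies.\<close>
    then have "trace X (\<Gamma> \<eta>) x = trace X (\<Gamma> \<eta>) y"
      using inj_on_image_eq_iff[OF inj_on_image_Pow[OF e(1)[OF \<eta>(1)]] trace_Pow trace_Pow] by simp
    moreover have "trace X (\<Gamma> \<eta>) x \<noteq> trace X (\<Gamma> \<eta>) y"
      using trace_neq[OF \<Gamma>(1)[OF \<eta>(1)] \<Gamma>(3)[OF \<eta>(1)] xy \<eta>(2)] .
    ultimately show False by blast
  qed
  moreover have "f x \<subseteq> Field \<delta> \<times> Pow (Field \<kappa>)" for x
    unfolding f_def using trace_Pow e(2) by fast
  then have "f ` topspace X \<subseteq> Pow (Field \<delta> \<times> Pow (Field \<kappa>))" by blast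
  ultimately have "|topspace X| \<le>o |Pow (Field \<delta> \<times> Pow (Field \<kappa>))|"
    using card_of_ordLeq[of "topspace X" "Pow (Field \<delta> \<times> Pow (Field \<kappa>))"] by blast
  then show ?thesis using card_of_Pow_Times_Pow_ordLeq by (rule ordLeq_transitive)
qed

theorem theorem4p3:
  fixes X :: "'a topology"
  assumes "Urysohn_space X"
  shows "|topspace X| \<le>o ctwo ^c (regular_diagonal_degree X *c (ctwo ^c weak_Lindelof_number X))"
  using card_topspace_ordLeq[OF regular_diagonal_degree(2)[OF assms] weak_Lindelof_number(2)]
    weak_Lindelof_number(1) by blast

end
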